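(* Let $B$ be a finite Boolean algebra equipped with a preconditional $\to$ satisfying modus ponens, identity, normality, and negation import. Let $W$ be the set of atoms of $B$ and let $\widehat{(\cdot)}$ be the isomorphism from $B$ to $\wp(W)$, $\widehat{a}=\{w\in W\mid w\leq a\}$. For $a\in B$ and $w,v\in W$, define $$wR_{\widehat{a}}v\ \text{ iff for all } b\in B,\ w\leq a\to b \text{ implies } v\leq b.$$ Then $(W,\{R_A\}_{A\subseteq W})$ is a strongly dense, functional selection frame, and $(B,\to)$ is isomorphic to $(\wp(W),\to_R)$, where $A\to_R C:=\{w\in W\mid \text{for all } v\in W,\ wR_Av\Rightarrow v\in C\}$.
   Context: A preconditional on a bounded lattice $L$ is a binary operation $\to$ on $L$ such that for all $a,b,c\in L$: (1) $1\to a\leq a$; (2) $a\wedge b\leq a\to b$; (3) $a\to b\leq a\to(a\wedge b)$; (4) $a\to(b\wedge c)\leq a\to b$; (5) $a\to((a\wedge b)\to c)\leq (a\wedge b)\to c$. Further axioms (for all $a,b,c$): modus ponens: $a\wedge(a\to b)\leq b$; identity: $a\to a=1$; normality: $(a\to b)\wedge(a\to c)\leq a\to(b\wedge c)$; negation import: $\neg(a\to b)\leq a\to\neg b$, where $\neg$ is Boolean complement. A selection frame is a pair $(W,\{R_A\}_{A\subseteq W})$ where $W$ is a nonempty set and each $R_A$ is a binary relation on $W$ such that for all $w,v\in W$ and $A\subseteq W$: (success) if $wR_Av$, then $v\in A$; (centering) if $w\in A$, then $wR_Av$ iff $v=w$. It is functional if $wR_Av$ and $wR_Au$ imply $v=u$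 (for all $w,v,u\in W$, $A\subseteq W$). It is strongly dense if for all $w,v\in W$ and $A,B\subseteq W$: if $wR_{A\cap B}v$, then there is $u\in W$ with $wR_Au$ and $uR_{A\cap B}v$. *)

theory Defs
  imports Main
begin

locale preconditional =
  fixes imp :: "'a::bounded_lattice \<Rightarrow> 'a \<Rightarrow> 'a"  (infixr "\<rightarrow>" 75)
  assumes top_imp: "top \<rightarrow> a \<le> a"
    and inf_le_imp: "inf a b \<le> a \<rightarrow> b"
    and imp_le_imp_inf: "a \<rightarrow> b \<le> a \<rightarrow> (inf a b)"
    and imp_inf_le: "a \<rightarrow> (inf b c) \<le> a \<rightarrow> b"
    and imp_imp_le: "a \<rightarrow> ((inf a b) \<rightarrow> c) \<le> (inf a b) \<rightarrow> c"

definition modus_ponens :: "('a::bounded_lattice \<Rightarrow> 'a \<Rightarrow> 'a) \<Rightarrow> bool" where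
  "modus_ponens imp \<longleftrightarrow> (\<forall>a b. inf a (imp a b) \<le> b)"

definition identity :: "('a::bounded_lattice \<Rightarrow> 'a \<Rightarrow> 'a) \<Rightarrow> bool" where
  "identity imp \<longleftrightarrow> (\<forall>a. imp a a = top)"

definition normality :: "('a::bounded_lattice \<Rightarrow> 'a \<Rightarrow> 'a) \<Rightarrow> bool" where
  "normality imp \<longleftrightarrow> (\<forall>a b c. inf (imp a b) (imp a c) \<le> imp a (inf b c))"

definition negation_import :: "('a::boolean_algebra \<Rightarrow> 'a \<Rightarrow> 'a) \<Rightarrow> bool" where
  "negation_import imp \<longleftrightarrow> (\<forall>a b. - imp a b \<le> imp a (- b))"

text \<open>In the frame notions below only the values \<open>R A\<close> for \<open>A \<subseteq> W\<close> matter.\<close>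

locale selection_frame =
  fixes W :: "'w set" and R :: "'w set \<Rightarrow> 'w rel"
  assumes nonempty: "W \<noteq> {}"
    and rel_on: "A \<subseteq> W \<Longrightarrow> R A \<subseteq> W \<times> W"
    and success: "A \<subseteq> W \<Longrightarrow> w \<in> W \<Longrightarrow> v \<in> W \<Longrightarrow> (w, v) \<in> R A \<Longrightarrow> v \<in> A"
    and centering: "A \<subseteq> W \<Longrightarrow> w \<in> W \<Longrightarrow> v \<in> W \<Longrightarrow> w \<in> A \<Longrightarrow> (w, v) \<in> R A \<longleftrightarrow> v = w"

definition functional :: "'w set \<Rightarrow> ('w set \<Rightarrow> 'w rel) \<Rightarrow> bool" where
  "functional W R \<longleftrightarrow>
    (\<forall>A\<subseteq>W. \<forall>w\<in>W. \<forall>v\<in>W. \<forall>u\<in>W. (w, v) \<in> R A \<longrightarrow> (w, u) \<in> R A \<longrightarrow> v = u)"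

definition strongly_dense :: "'w set \<Rightarrow> ('w set \<Rightarrow> 'w rel) \<Rightarrow> bool" where
  "strongly_dense W R \<longleftrightarrow>
    (\<forall>A\<subseteq>W. \<forall>B\<subseteq>W. \<forall>w\<in>W. \<forall>v\<in>W. (w, v) \<in> R (A \<inter> B) \<longrightarrow>
      (\<exists>u\<in>W. (w, u) \<in> R A \<and> (u, v) \<in> R (A \<inter> B)))"

definition frame_imp :: "'w set \<Rightarrow> ('w set \<Rightarrow> 'w rel) \<Rightarrow> 'w set \<Rightarrow> 'w set \<Rightarrow> 'w set" where
  "frame_imp W R A C = {w \<in> W. \<forall>v\<in>W. (w, v) \<in> R A \<longrightarrow> v \<in> C}"

text \<open>Isomorphism of a Boolean algebra with a binary operation, given by a type, onto the
  powerset algebra of \<open>W\<close> with a binary operation.\<close>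

definition powerset_isomorphism ::
    "('a::boolean_algebra \<Rightarrow> 'a \<Rightarrow> 'a) \<Rightarrow> 'w set \<Rightarrow> ('w set \<Rightarrow> 'w set \<Rightarrow> 'w set) \<Rightarrow>
      ('a \<Rightarrow> 'w set) \<Rightarrow> bool" where
  "powerset_isomorphism imp W op \<phi> \<longleftrightarrow>
    bij_betw \<phi> UNIV (Pow W) \<and>
    \<phi> bot = {} \<and> \<phi> top = W \<and>
    (\<forall>a b. \<phi> (inf a b) = \<phi> a \<inter> \<phi> b) \<and>
    (\<forall>a b. \<phi> (sup a b) = \<phi> a \<union> \<phi> b) \<and>
    (\<forall>a. \<phi> (- a) = W - \<phi> a) \<and>
    (\<forall>a b. \<phi> (imp a b) = op (\<phi> a) (\<phi> b))"

definition isomorphic_to_powerset ::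
    "('a::boolean_algebra \<Rightarrow> 'a \<Rightarrow> 'a) \<Rightarrow> 'w set \<Rightarrow> ('w set \<Rightarrow> 'w set \<Rightarrow> 'w set) \<Rightarrow> bool" where
  "isomorphic_to_powerset imp W op \<longleftrightarrow> (\<exists>\<phi>. powerset_isomorphism imp W op \<phi>)"

definition atoms :: "'a::boolean_algebra set" where
  "atoms = {w. w \<noteq> bot \<and> (\<forall>x. x < w \<longrightarrow> x = bot)}"

definition hat :: "'a::boolean_algebra \<Rightarrow> 'a set" where
  "hat a = {w \<in> atoms. w \<le> a}"

text \<open>The relations are indexed by sets of atoms; in a finite Boolean algebra every such set is
  \<open>hat a\<close> for a unique \<open>a\<close>, so the quantifier over \<open>a\<close> merely undoes the indexing
  (lemmas \<open>bij_betw_hat\<close> and \<open>canonical_rel_hat\<close> below).\<close>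

definition canonical_rel :: "('a::boolean_algebra \<Rightarrow> 'a \<Rightarrow> 'a) \<Rightarrow> 'a set \<Rightarrow> 'a rel" where
  "canonical_rel imp A = {(w, v). w \<in> atoms \<and> v \<in> atoms \<and>
    (\<exists>a. A = hat a \<and> (\<forall>b. w \<le> imp a b \<longrightarrow> v \<le> b))}"

lemma exists_atom_le:
  fixes a :: "'a::{boolean_algebra,finite}"
  assumes "a \<noteq> bot"
  shows "\<exists>w\<in>atoms. w \<le> a"
proof -
  let ?S = "{x. x \<noteq> bot \<and> x \<le> a}"
  have "finite ?S" "?S \<noteq> {}"
    using assms by auto
  then obtain m where m: "m \<in> ?S" and min: "\<forall>b\<in>?S. b \<le> m \<longrightarrow> m = b"
    using finite_has_minimal[of ?S] by blast
  have "x = bot" if "x < m" for x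
  proof (rule ccontr)
    assume "x \<noteq> bot"
    then have "x \<in> ?S"
      using that m by auto
    then show False
      using that min by (blast dest: less_imp_neq order.strict_implies_order)
  qed
  then show ?thesis
    using m by (auto simp: atoms_def)
qed

lemma hat_subset_imp_le:
  fixes a b :: "'a::{boolean_algebra,finite}"
  assumes "hat a \<subseteq> hat b"
  shows "a \<le> b"
proof (rule ccontr)
  assume "\<not> a \<le> b"
  then have "inf a (- b) \<noteq> bot"
    using inf_shunt[of a "- b"] by simp
  then obtain w where w: "w \<in> atoms" "w \<le> inf a (- b)"
    using exists_atom_le by blast
  then have "w \<in> hat b"
    using assms by (auto simp: hat_def)
  then have "w \<le> inf b (- b)"
    using w unfolding hat_def by (blast intro: inf_greatest order.trans inf_le2)
  then show False
    using w by (simp add: atoms_def bot_unique)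
qed

lemma atom_le_sup:
  assumes "w \<in> atoms" "w \<le> sup a b"
  shows "w \<le> a \<or> w \<le> b"
proof (rule ccontr)
  assume n: "\<not> (w \<le> a \<or> w \<le> b)"
  then have "inf w a < w" "inf w b < w"
    by (metis inf.cobounded1 inf.absorb_iff1 order.not_eq_order_implies_strict)+
  then have "inf w a = bot" "inf w b = bot"
    using assms(1) by (auto simp: atoms_def)
  then have "inf w (sup a b) = bot"
    by (simp add: inf_sup_distrib1)
  then show False
    using assms by (simp add: atoms_def inf.absorb1)
qed

lemma exists_hat_eq:
  fixes A :: "'a::{boolean_algebra,finite} set"
  assumes "A \<subseteq> atoms"
  shows "\<exists>a. hat a = A"
proof -
  have "finite A" by simp
  from this assms show ?thesis
  proof (induction A rule: finite_induct)
    case empty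
    have "hat bot = ({} :: 'a set)"
      by (auto simp: hat_def atoms_def bot_unique)
    then show ?case ..
  next
    case (insert x A)
    then obtain a where a: "hat a = A" by auto
    have x: "x \<in> atoms" using insert.prems by simp
    have "w = x" if "w \<in> atoms" "w \<le> x" for w
      using that x by (auto simp: atoms_def order.order_iff_strict)
    then have "hat (sup x a) = insert x (hat a)"
      using x by (auto simp: hat_def dest: atom_le_sup intro: le_supI2)
    then show ?case using a by blast
  qed
qed

lemma bij_betw_hat: "bij_betw hat (UNIV :: 'a::{boolean_algebra,finite} set) (Pow atoms)"
  unfolding bij_betw_def
proof
  show "inj (hat :: 'a \<Rightarrow> 'a set)"
    by (rule injI) (simp add: hat_subset_imp_le order.antisym)
  show "range (hat :: 'a \<Rightarrow> 'a set) = Pow atoms"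
  proof
    show "range (hat :: 'a \<Rightarrow> 'a set) \<subseteq> Pow atoms"
      by (auto simp: hat_def)
    show "Pow atoms \<subseteq> range (hat :: 'a \<Rightarrow> 'a set)"
      using exists_hat_eq by (metis PowD rangeI subsetI)
  qed
qed

lemma canonical_rel_hat:
  fixes imp :: "'a::{boolean_algebra,finite} \<Rightarrow> 'a \<Rightarrow> 'a"
  shows "(w, v) \<in> canonical_rel imp (hat a) \<longleftrightarrow>
    w \<in> atoms \<and> v \<in> atoms \<and> (\<forall>b. w \<le> imp a b \<longrightarrow> v \<le> b)"
  using bij_betw_imp_inj_on[OF bij_betw_hat]
  by (auto simp: canonical_rel_def dest: injD)

end

theory Submission
  imports Defs
begin

text \<open>For an atom \<open>w\<close> and an element \<open>a\<close>, monotonicity and normality make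
  \<open>{b. w \<le> imp a b}\<close> a filter, and negation import makes it improper or an ultrafilter. As the
  algebra is finite, the filter is principal, generated by \<open>bot\<close> or by an atom; this generator
  is the only possible \<open>R\<close>-successor of \<open>w\<close>.\<close>

lemma preconditional_mono:
  assumes "preconditional imp" "b \<le> c"
  shows "imp a b \<le> imp a c"
  using preconditional.imp_inf_le[OF assms(1), of a c b] assms(2) by (simp add: inf.absorb2)

lemma atom_le_or_le_compl:
  assumes "w \<in> atoms"
  shows "w \<le> a \<or> w \<le> - a"
  using atom_le_sup[OF assms, of a "- a"] by simp

lemma atom_le_atom:
  assumes "v \<in> atoms" "w \<in> atoms" "v \<le> w"
  shows "v = w"
  using assms by (auto simp: atoms_def order.order_iff_strict)

lemma principal_successor_filter:
  fixes imp :: "'a::{boolean_algebra,finite} \<Rightarrow> 'a \<Rightarrow> 'a"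
  assumes pre: "preconditional imp" and ident: "identity imp" and nrm: "normality imp"
    and neg: "negation_import imp" and w: "w \<in> atoms"
  obtains m where "m = bot \<or> m \<in> atoms" "\<And>b. w \<le> imp a b \<longleftrightarrow> m \<le> b"
proof -
  let ?F = "{b. w \<le> imp a b}"
  \<comment> \<open>Identity makes the filter nonempty, so finiteness supplies a minimal
    element.\<close>
  have "a \<in> ?F"
    using ident by (simp add: identity_def)
  then obtain m where m: "m \<in> ?F" and min: "\<forall>b\<in>?F. b \<le> m \<longrightarrow> m = b"
    using finite_has_minimal[of ?F] by auto
  \<comment> \<open>Minimal becomes least: normality puts \<open>inf m b\<close> into
    \<open>?F\<close>, and it lies below \<open>m\<close>, so it equals \<open>m\<close>.\<close>
  have least: "m \<le> b" if "w \<le> imp a b" for b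
  proof -
    have "w \<le> inf (imp a m) (imp a b)"
      using m that by simp
    also have "\<dots> \<le> imp a (inf m b)"
      using nrm by (simp add: normality_def)
    finally have "m = inf m b"
      using min by simp
    then show ?thesis
      by (simp add: inf.absorb_iff1)
  qed
  have iff: "w \<le> imp a b \<longleftrightarrow> m \<le> b" for b
    using least m preconditional_mono[OF pre, of m b a] by (auto intro: order.trans)
  \<comment> \<open>Such an \<open>x\<close> is outside the filter, so negation import puts
    \<open>- x\<close> inside. Hence \<open>x \<le> m \<le> - x\<close>, and \<open>x\<close> is
    disjoint from itself.\<close>
  have "x = bot" if "x < m" for x
  proof -
    have "\<not> w \<le> imp a x"
      using iff that by auto
    then have "w \<le> - imp a x"
      using atom_le_or_le_compl[OF w] by blast
    also have "\<dots> \<le> imp a (- x)"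
      using neg by (simp add: negation_import_def)
    finally have "x \<le> - x"
      using iff that by (auto intro: order.trans)
    then show ?thesis
      using inf_shunt[of x x] by simp
  qed
  then have "m = bot \<or> m \<in> atoms"
    by (auto simp: atoms_def)
  then show ?thesis
    using iff that by blast
qed

text \<open>The definition of the relation gives only one direction. Applied to the generator
  \<open>m\<close>, it yields \<open>v \<le> m\<close>; as \<open>v\<close> is an atom,
  \<open>m\<close> is not \<open>bot\<close>, hence is an atom and equals \<open>v\<close>.\<close>

lemma canonical_rel_unique:
  fixes imp :: "'a::{boolean_algebra,finite} \<Rightarrow> 'a \<Rightarrow> 'a"
  assumes "preconditional imp" "identity imp" "normality imp" "negation_import imp"
    and "(w, v) \<in> canonical_rel imp (hat a)"
  shows "w \<le> imp a b \<longleftrightarrow> v \<le> b"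
proof -
  have w: "w \<in> atoms" and v: "v \<in> atoms" and R: "\<And>b. w \<le> imp a b \<Longrightarrow> v \<le> b"
    using assms(5) by (auto simp: canonical_rel_hat)
  obtain m where m: "m = bot \<or> m \<in> atoms" "\<And>b. w \<le> imp a b \<longleftrightarrow> m \<le> b"
    using principal_successor_filter[OF assms(1-4) w] by blast
  have "v \<le> m"
    using R m(2) by blast
  then have "v = m"
    using m(1) v atom_le_atom by (auto simp: atoms_def bot_unique)
  then show ?thesis
    using m(2) by simp
qed

text \<open>If \<open>w \<le> imp a b\<close> fails, the generator of the filter is not below
  \<open>b\<close>. So it is not \<open>bot\<close> but an atom, and it serves as
  \<open>v\<close>.\<close>

lemma canonical_rel_witness:
  fixes imp :: "'a::{boolean_algebra,finite} \<Rightarrow> 'a \<Rightarrow> 'a"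
  assumes "preconditional imp" "identity imp" "normality imp" "negation_import imp"
    and "w \<in> atoms" "\<not> w \<le> imp a b"
  obtains v where "(w, v) \<in> canonical_rel imp (hat a)" "\<not> v \<le> b"
  using principal_successor_filter[OF assms(1-5), of a] assms(5,6)
  by (metis bot_least canonical_rel_hat)

lemma hat_inf: "hat (inf a b) = hat a \<inter> hat b"
  by (auto simp: hat_def)

lemma hat_sup: "hat (sup a b) = hat a \<union> hat b"
  by (auto simp: hat_def dest: atom_le_sup intro: le_supI1 le_supI2)

lemma hat_bot: "hat bot = {}"
  by (auto simp: hat_def atoms_def bot_unique)

lemma hat_top: "hat top = atoms"
  by (simp add: hat_def)

lemma hat_compl: "hat (- a) = atoms - hat a"
proof -
  have "hat a \<inter> hat (- a) = {}" "hat a \<union> hat (- a) = atoms"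
    by (simp_all add: hat_bot hat_top flip: hat_inf hat_sup)
  then show ?thesis
    by blast
qed

theorem proposition7:
  fixes imp :: "'a::{boolean_algebra,finite} \<Rightarrow> 'a \<Rightarrow> 'a"
  assumes "(bot :: 'a) \<noteq> top"
    and "preconditional imp"
    and "modus_ponens imp"
    and "identity imp"
    and "normality imp"
    and "negation_import imp"
  shows "selection_frame (atoms :: 'a set) (canonical_rel imp)
    \<and> strongly_dense (atoms :: 'a set) (canonical_rel imp)
    \<and> functional (atoms :: 'a set) (canonical_rel imp)
    \<and> isomorphic_to_powerset imp (atoms :: 'a set) (frame_imp atoms (canonical_rel imp))"
proof (intro conjI)
  note unique = canonical_rel_unique[OF assms(2,4-6)]
  note witness = canonical_rel_witness[OF assms(2,4-6)]
  show "selection_frame (atoms :: 'a set) (canonical_rel imp)"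
  proof
    show "(atoms :: 'a set) \<noteq> {}"
      using exists_atom_le[of "top :: 'a"] assms(1) by auto
    show "canonical_rel imp A \<subseteq> atoms \<times> atoms" for A
      by (auto simp: canonical_rel_def)
    fix A :: "'a set" and w v :: 'a
    assume "A \<subseteq> atoms" and w: "w \<in> atoms" and v: "v \<in> atoms"
    then obtain a where A: "A = hat a"
      using exists_hat_eq by blast
    \<comment> \<open>By identity, \<open>a\<close> belongs to the filter that \<open>v\<close>
      generates.\<close>
    show "v \<in> A" if "(w, v) \<in> canonical_rel imp A"
      using that v assms(4) unique[of w v a a] by (simp add: A hat_def identity_def)
    assume "w \<in> A"
    then have "w \<le> a"
      by (simp add: A hat_def)
    \<comment> \<open>Modus ponens gives one direction, \<open>inf a b \<le> imp a b\<close> the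
      other. The successors of \<open>w\<close> are thus the atoms below \<open>w\<close>, which is
      \<open>w\<close> alone.\<close>
    then have "w \<le> imp a b \<longleftrightarrow> w \<le> b" for b
      using assms(3) preconditional.inf_le_imp[OF assms(2), of a b]
      unfolding modus_ponens_def by (meson inf_greatest order.trans)
    then show "(w, v) \<in> canonical_rel imp A \<longleftrightarrow> v = w"
      using v w atom_le_atom by (auto simp: A canonical_rel_hat)
  qed
  show "functional (atoms :: 'a set) (canonical_rel imp)"
    \<comment> \<open>For successors \<open>v\<close> and \<open>u\<close>, \<open>unique\<close>
      with \<open>b = v\<close> gives \<open>w \<le> imp a v\<close>, hence
      \<open>u \<le> v\<close>; the converse is symmetric.\<close>
    unfolding functional_def using unique exists_hat_eq by (metis order.eq_iff)
  show "strongly_dense (atoms :: 'a set) (canonical_rel imp)"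
    unfolding strongly_dense_def
  proof (intro allI ballI impI)
    fix A B :: "'a set" and w v :: 'a
    assume "A \<subseteq> atoms" "B \<subseteq> atoms" and w: "w \<in> atoms" and v: "v \<in> atoms"
      and "(w, v) \<in> canonical_rel imp (A \<inter> B)"
    moreover obtain a b where AB: "A = hat a" "B = hat b"
      using calculation exists_hat_eq by metis
    ultimately have R: "(w, v) \<in> canonical_rel imp (hat (inf a b))"
      by (simp add: hat_inf)
    \<comment> \<open>The fifth preconditional axiom, evaluated at \<open>w\<close>, whose successor
      under \<open>inf a b\<close> is \<open>v\<close>.\<close>
    have import: "v \<le> c" if "w \<le> imp a (imp (inf a b) c)" for c
      using that preconditional.imp_imp_le[OF assms(2)] unique[OF R] by (blast intro: order.trans)
    \<comment> \<open>With \<open>c = bot\<close>, \<open>import\<close> would force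
      \<open>v = bot\<close>. So the filter of \<open>w\<close> at \<open>a\<close> is proper, and
      the intermediate point \<open>u\<close> exists.\<close>
    have "\<not> w \<le> imp a (imp (inf a b) bot)"
      using import[of bot] v by (auto simp: atoms_def bot_unique)
    then obtain u where u: "(w, u) \<in> canonical_rel imp (hat a)"
      using witness[OF w] by blast
    then have "u \<in> atoms"
      by (simp add: canonical_rel_hat)
    \<comment> \<open>By \<open>unique[OF u]\<close>, \<open>u \<le> imp (inf a b) c\<close> means
      \<open>w \<le> imp a (imp (inf a b) c)\<close>, so \<open>import\<close> is exactly the
      required condition.\<close>
    moreover from this have "(u, v) \<in> canonical_rel imp (hat (inf a b))"
      using v unique[OF u] import by (simp add: canonical_rel_hat)
    ultimately show "\<exists>u\<in>atoms. (w, u) \<in> canonical_rel imp A \<and> (u, v) \<in> canonical_rel imp (A \<inter> B)"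
      using u by (auto simp: AB hat_inf)
  qed
  have "hat (imp a b) = frame_imp atoms (canonical_rel imp) (hat a) (hat b)" for a b
  proof -
    \<comment> \<open>Left to right is the defining condition of the relation; the converse is the
      contrapositive of \<open>witness\<close>.\<close>
    have "w \<le> imp a b \<longleftrightarrow> (\<forall>v\<in>atoms. (w, v) \<in> canonical_rel imp (hat a) \<longrightarrow> v \<le> b)"
      if "w \<in> atoms" for w
      using that unique witness[OF that] by (metis canonical_rel_hat)
    then show ?thesis
      by (auto simp: frame_imp_def hat_def)
  qed
  then show "isomorphic_to_powerset imp (atoms :: 'a set) (frame_imp atoms (canonical_rel imp))"
    unfolding isomorphic_to_powerset_def powerset_isomorphism_def
    using bij_betw_hat hat_bot hat_top hat_inf hat_sup hat_compl by blast
qed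

end
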